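(* For all $\tau\in\mathbb{H}$, with $E=\left(\frac{\eta(\tau)}{\eta(7\tau)}\right)^4$, $$\frac{v^4u^2}{w^6}+\frac{u^4w^2}{v^6}+\frac{w^4v^2}{u^6}=E^2+14E+54,$$ $$\frac{w^6}{v^4u^2}+\frac{v^6}{u^4w^2}+\frac{u^6}{w^4v^2}=E^2+12E+41.$$
   Context: Let $\tau\in\mathbb{H}$, $q=e^{2\pi i\tau}$, $q^{\alpha}=e^{2\pi i\alpha\tau}$. Define $u=q^{1/56}\prod_{k\ge0}(1-q^{7k+3})(1-q^{7k+4})(1-q^{7k+7})$, $v=q^{9/56}\prod_{k\ge0}(1-q^{7k+2})(1-q^{7k+5})(1-q^{7k+7})$, $w=q^{25/56}\prod_{k\ge0}(1-q^{7k+1})(1-q^{7k+6})(1-q^{7k+7})$, and $\eta(\tau)=q^{1/24}\prod_{n\ge1}(1-q^n)$. *)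

theory Defs
  imports "HOL-Analysis.Analysis"
begin

definition qpow :: "real \<Rightarrow> complex \<Rightarrow> complex" where
  "qpow \<alpha> \<tau> = exp (2 * of_real pi * \<i> * of_real \<alpha> * \<tau>)"

definition nome :: "complex \<Rightarrow> complex" where
  "nome \<tau> = exp (2 * of_real pi * \<i> * \<tau>)"

definition ru :: "complex \<Rightarrow> complex" where
  "ru \<tau> = qpow (1/56) \<tau> *
     (\<Prod>k. (1 - nome \<tau> ^ (7*k+3)) * (1 - nome \<tau> ^ (7*k+4)) * (1 - nome \<tau> ^ (7*k+7)))"

definition rv :: "complex \<Rightarrow> complex" where
  "rv \<tau> = qpow (9/56) \<tau> *
     (\<Prod>k. (1 - nome \<tau> ^ (7*k+2)) * (1 - nome \<tau> ^ (7*k+5)) * (1 - nome \<tau> ^ (7*k+7)))"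

definition rw :: "complex \<Rightarrow> complex" where
  "rw \<tau> = qpow (25/56) \<tau> *
     (\<Prod>k. (1 - nome \<tau> ^ (7*k+1)) * (1 - nome \<tau> ^ (7*k+6)) * (1 - nome \<tau> ^ (7*k+7)))"

definition deta :: "complex \<Rightarrow> complex" where
  "deta \<tau> = qpow (1/24) \<tau> * (\<Prod>n. (1 - nome \<tau> ^ (Suc n)))"

end

theory Submission
  imports Defs
begin

text \<open>
  With \<open>\<theta>(x)\<close> the theta function of nome \<open>q^7\<close>, the numbers \<open>w, v, u\<close> are, up to a common factor
  and powers of \<open>q\<close>, the values \<open>a = \<theta>(q)\<close>, \<open>b = \<theta>(q^2)\<close>, \<open>c = \<theta>(q^3)\<close> at the 7-torsion points of an
  elliptic curve, and \<open>E = (a b c)^4 / q\<close>. The Weierstrass function \<open>P\<close> of the curve has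
  \<open>P x - P y = y \<theta>(x y) \<theta>(x / y) / (\<theta>(x) \<theta>(y))^2\<close>, so the differences of its values at the torsion
  points are monomials in \<open>a, b, c\<close>; this yields the Klein quartic, which makes \<open>v^2 u / w^3 = A\<close>,
  \<open>u^2 w / v^3 = (A - 1) / A\<close> and \<open>w^2 v / u^3 = 1 / (A - 1)\<close>. The values of the Weierstrass cubic at
  the three torsion points are monomials too (by the duplication formula), so they determine the
  cubic by interpolation as a function of \<open>A\<close>. Comparing its discriminant with the product formula
  gives \<open>E A (A - 1) = A^3 - 8 A^2 + 5 A + 1\<close>, and the two identities are then rational
  function identities in \<open>A\<close>.
\<close>

section \<open>Theta products\<close>

text \<open>The q-Pochhammer symbol (z;p)_infinity.\<close>

definition qprod :: "complex \<Rightarrow> complex \<Rightarrow> complex" where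
  "qprod z p = (\<Prod>n. 1 - z * p ^ n)"

lemma convergent_qprod:
  fixes z p :: complex
  assumes "norm p < 1"
  shows "convergent_prod (\<lambda>n. 1 - z * p ^ n)"
proof -
  have "summable (\<lambda>n. norm z * norm p ^ n)"
    using assms by (intro summable_mult summable_geometric) auto
  then have "summable (\<lambda>n. norm ((1 - z * p ^ n) - 1))"
    by (simp add: norm_mult norm_power)
  then show ?thesis
    by (intro abs_convergent_prod_imp_convergent_prod summable_imp_abs_convergent_prod)
qed

lemma qprod_tendsto:
  assumes "norm p < 1"
  shows "(\<lambda>n. \<Prod>k<n. 1 - z * p ^ k) \<longlonglongrightarrow> qprod z p"
  unfolding qprod_def
  using has_prod_imp_tendsto'[OF convergent_prod_has_prod[OF convergent_qprod[OF assms]]] .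

lemma qprod_eq_0_iff:
  assumes "norm p < 1"
  shows "qprod z p = 0 \<longleftrightarrow> (\<exists>n. z * p ^ n = 1)"
  using has_prod_eq_0_iff[OF convergent_prod_has_prod[OF convergent_qprod[OF assms, of z]]]
  unfolding qprod_def by (auto simp: image_iff) 

lemma qprod_neq_0:
  assumes "norm p < 1" "norm z < 1"
  shows "qprod z p \<noteq> 0"
proof
  assume "qprod z p = 0"
  then obtain n where "z * p ^ n = 1"
    using qprod_eq_0_iff assms by blast
  then have "norm z * norm p ^ n = 1"
    by (metis norm_mult norm_one norm_power)
  moreover have "norm z * norm p ^ n \<le> norm z * 1"
    using assms by (intro mult_left_mono power_le_one) auto
  ultimately show False using assms by simp
qed

lemma qprod_unfold:
  assumes "norm p < 1"
  shows "qprod z p = (1 - z) * qprod (z * p) p"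
proof (rule LIMSEQ_unique)
  show "(\<lambda>n. \<Prod>k<Suc n. 1 - z * p ^ k) \<longlonglongrightarrow> qprod z p"
    using qprod_tendsto[OF assms] by (rule LIMSEQ_Suc)
  have "(\<lambda>n. (1 - z) * (\<Prod>k<n. 1 - (z * p) * p ^ k)) \<longlonglongrightarrow> (1 - z) * qprod (z * p) p"
    by (intro tendsto_intros qprod_tendsto assms)
  then show "(\<lambda>n. \<Prod>k<Suc n. 1 - z * p ^ k) \<longlonglongrightarrow> (1 - z) * qprod (z * p) p"
    by (simp add: prod.lessThan_Suc_shift mult.assoc del: prod.lessThan_Suc)
qed

lemma qprod_mult_minus:
  assumes "norm p < 1"
  shows "qprod z p * qprod (- z) p = qprod (z^2) (p^2)"
proof (rule LIMSEQ_unique)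
  have p2: "norm (p^2) < 1"
    using assms by (simp add: norm_power power_less_one_iff)
  show "(\<lambda>n. \<Prod>k<n. 1 - z^2 * (p^2) ^ k) \<longlonglongrightarrow> qprod (z^2) (p^2)"
    by (rule qprod_tendsto[OF p2])
  have "(\<lambda>n. (\<Prod>k<n. 1 - z * p ^ k) * (\<Prod>k<n. 1 - (- z) * p ^ k)) \<longlonglongrightarrow> qprod z p * qprod (- z) p"
    by (intro tendsto_intros qprod_tendsto assms)
  also have "(\<lambda>n. (\<Prod>k<n. 1 - z * p ^ k) * (\<Prod>k<n. 1 - (- z) * p ^ k)) = (\<lambda>n. \<Prod>k<n. 1 - z^2 * (p^2) ^ k)"
    by (auto simp: prod.distrib[symmetric] algebra_simps power2_eq_square power_mult_distrib
             intro!: prod.cong)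
  finally show "(\<lambda>n. \<Prod>k<n. 1 - z^2 * (p^2) ^ k) \<longlonglongrightarrow> qprod z p * qprod (- z) p" .
qed

text \<open>The factors are grouped by the residue of the exponent modulo m, and the limit is taken
  along partial products of length \<open>n * m\<close>.\<close>

lemma qprod_split:
  assumes "norm p < 1" "m > 0"
  shows "qprod z p = (\<Prod>j<m. qprod (z * p ^ j) (p ^ m))"
proof (rule LIMSEQ_unique)
  have pm: "norm (p ^ m) < 1"
    using assms by (simp add: norm_power power_less_one_iff)
  show "(\<lambda>n. \<Prod>k<n * m. 1 - z * p ^ k) \<longlonglongrightarrow> qprod z p"
    by (rule filterlim_compose[OF qprod_tendsto[OF assms(1)]])
       (use assms(2) in \<open>simp add: mult_nat_right_at_top\<close>)
  have "(\<lambda>n. \<Prod>j<m. \<Prod>i<n. 1 - (z * p ^ j) * (p ^ m) ^ i) \<longlonglongrightarrow> (\<Prod>j<m. qprod (z * p ^ j) (p ^ m))"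
    by (intro tendsto_intros qprod_tendsto pm)
  also have "(\<lambda>n. \<Prod>j<m. \<Prod>i<n. 1 - (z * p ^ j) * (p ^ m) ^ i) = (\<lambda>n. \<Prod>k<n * m. 1 - z * p ^ k)"
  proof
    fix n
    have "(\<Prod>k<n * m. 1 - z * p ^ k) = (\<Prod>i<n. \<Prod>k=i*m..<i*m+m. 1 - z * p ^ k)"
      by (rule prod.nat_group[symmetric])
    also have "\<dots> = (\<Prod>i<n. \<Prod>j<m. 1 - (z * p ^ j) * (p ^ m) ^ i)"
    proof (rule prod.cong[OF refl])
      fix i
      show "(\<Prod>k=i*m..<i*m+m. 1 - z * p ^ k) = (\<Prod>j<m. 1 - (z * p ^ j) * (p ^ m) ^ i)"
        by (rule prod.reindex_bij_witness[of _ "\<lambda>j. j + i * m" "\<lambda>k. k - i * m"])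
           (auto simp: power_add[symmetric] power_mult[symmetric] mult.commute mult.assoc)
    qed
    finally show "(\<Prod>j<m. \<Prod>i<n. 1 - (z * p ^ j) * (p ^ m) ^ i) = (\<Prod>k<n * m. 1 - z * p ^ k)"
      by (subst prod.swap) simp
  qed
  finally show "(\<lambda>n. \<Prod>k<n * m. 1 - z * p ^ k) \<longlonglongrightarrow> (\<Prod>j<m. qprod (z * p ^ j) (p ^ m))" .
qed

lemma qprod_split2:
  assumes "norm p < 1"
  shows "qprod z p = qprod z (p^2) * qprod (z * p) (p^2)"
  using qprod_split[OF assms, of 2 z] by (simp add: numeral_2_eq_2)

section \<open>Quasi-periodicity, duplication and half-period values of theta\<close>

text \<open>The modified theta function, that is, Jacobi's product without the factor
  (p;p)_infinity. For 0 < |p| < 1 its zeros in the punctured plane are the integer powers of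
  p.\<close>

definition theta :: "complex \<Rightarrow> complex \<Rightarrow> complex" where
  "theta z p = qprod z p * qprod (p / z) p"

lemma theta_nome_divide:
  assumes "p \<noteq> 0" "z \<noteq> 0"
  shows "theta (p / z) p = theta z p"
  using assms by (simp add: theta_def)

text \<open>Passing from z to pz removes the factor 1 - z from one product and adds 1 - 1/z to the
  other; their quotient is -1/z.\<close>

lemma theta_nome_mult:
  assumes "norm p < 1" "p \<noteq> 0" "z \<noteq> 0"
  shows "theta (p * z) p = - theta z p / z"
proof -
  have "qprod z p = (1 - z) * qprod (p * z) p" "qprod (1 / z) p = (1 - 1 / z) * qprod (p / z) p"
    using qprod_unfold[OF assms(1), of z] qprod_unfold[OF assms(1), of "1 / z"]
    by (simp_all add: mult.commute)
  moreover have "theta (p * z) p = qprod (p * z) p * qprod (1 / z) p"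
    using assms by (simp add: theta_def)
  ultimately have "theta (p * z) p = qprod (p * z) p * ((1 - 1 / z) * qprod (p / z) p)"
    and "theta z p = (1 - z) * qprod (p * z) p * qprod (p / z) p"
    by (simp_all add: theta_def)
  note this[simp]
  show ?thesis
    using assms by (simp add: field_simps)
qed

lemma theta_inverse:
  assumes "norm p < 1" "p \<noteq> 0" "z \<noteq> 0"
  shows "theta (1 / z) p = - theta z p / z"
  using theta_nome_divide[of p "1 / z"] theta_nome_mult[of p z] assms by simp

text \<open>The four arguments are the translates of z by the half periods 1, -1, s, -s. Multiplying
  opposite pairs gives products of nome p^2, which recombine to nome p by parity of the
  exponent.\<close>

lemma theta_duplication:
  assumes "norm p < 1" "p \<noteq> 0" "z \<noteq> 0" "s^2 = p"
  shows "theta z p * theta (- z) p * theta (z * s) p * theta (- (z * s)) p = theta (z^2) p"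
proof -
  have s: "s \<noteq> 0" using assms by auto
  have ps: "p / (z * s) = s / z" using s assms(4)[symmetric] by (simp add: power2_eq_square)
  have "qprod z p * qprod (- z) p * (qprod (z * s) p * qprod (- (z * s)) p) = qprod (z^2) p"
    using assms by (simp add: qprod_mult_minus qprod_split2[of p "z^2"] power_mult_distrib)
  moreover have "qprod (p / z) p * qprod (- (p / z)) p * (qprod (s / z) p * qprod (- (s / z)) p)
      = qprod (p / z^2) p"
  proof -
    have "(p / z)^2 = p / z^2 * p" "(s / z)^2 = p / z^2"
      using assms by (simp_all add: power_divide power2_eq_square)
    then show ?thesis
      using qprod_mult_minus[OF assms(1), of "p / z"] qprod_mult_minus[OF assms(1), of "s / z"]
        qprod_split2[OF assms(1), of "p / z^2"] by (simp add: mult.commute)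
  qed
  moreover have "theta z p * theta (- z) p * theta (z * s) p * theta (- (z * s)) p =
      (qprod z p * qprod (- z) p * (qprod (z * s) p * qprod (- (z * s)) p)) *
      (qprod (p / z) p * qprod (- (p / z)) p * (qprod (s / z) p * qprod (- (s / z)) p))"
    unfolding theta_def using ps by (simp add: mult_ac)
  ultimately show ?thesis
    by (simp add: theta_def)
qed

text \<open>The product equals 2 ((p;p^2)(-p;p))^2, and the bracket is 1 by Euler's identity on odd
  and distinct parts. It also shows that theta does not vanish at the half periods.\<close>

lemma theta_half_periods:
  assumes "norm p < 1" "p \<noteq> 0" "s^2 = p"
  shows "theta (- 1) p * theta s p * theta (- s) p = 2"
proof -
  have s: "s \<noteq> 0" using assms by auto
  have ps: "p / s = s" using s assms(3)[symmetric] by (simp add: power2_eq_square)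
  have p2: "norm (p^2) < 1" using assms(1) by (simp add: norm_power power_less_one_iff)
  have "qprod (p^2) (p^2) \<noteq> 0" by (rule qprod_neq_0[OF p2 p2])
  \<comment> \<open>Euler's identity comes from computing (p;p)(-p;p) = (p^2;p^2) with (p;p) split
    by parity and cancelling (p^2;p^2).\<close>
  moreover have "qprod p (p^2) * qprod (p^2) (p^2) * qprod (- p) p = qprod (p^2) (p^2)"
    using qprod_mult_minus[OF assms(1), of p] qprod_split2[OF assms(1), of p]
    by (simp add: power2_eq_square)
  ultimately have euler: "qprod p (p^2) * qprod (- p) p = 1"
    by simp
  have "qprod s p * qprod (- s) p = qprod p (p^2)"
    using qprod_mult_minus[OF assms(1), of s] assms(3) by simp
  moreover have "qprod (- 1) p = 2 * qprod (- p) p"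
    using qprod_unfold[OF assms(1), of "- 1"] by simp
  moreover have "theta (- 1) p * theta s p * theta (- s) p
      = qprod (- 1) p * qprod (- p) p * (qprod s p * qprod (- s) p)^2"
    unfolding theta_def using ps by (simp add: power2_eq_square)
  ultimately have "theta (- 1) p * theta s p * theta (- s) p = 2 * (qprod p (p^2) * qprod (- p) p)^2"
    by (simp add: power2_eq_square)
  with euler show ?thesis by simp
qed

section \<open>The Jacobi triple product\<close>

text \<open>Gaussian binomial coefficients, given by the q-Pascal rule so that no division by a
  possibly vanishing 1 - p^j occurs.\<close>

fun qbinomial :: "complex \<Rightarrow> nat \<Rightarrow> nat \<Rightarrow> complex" where
  "qbinomial p n 0 = 1"
| "qbinomial p 0 (Suc k) = 0"
| "qbinomial p (Suc n) (Suc k) = qbinomial p n k + p ^ Suc k * qbinomial p n (Suc k)"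

lemma qbinomial_eq_0: "n < k \<Longrightarrow> qbinomial p n k = 0"
  by (induction p n k rule: qbinomial.induct) auto

lemma qbinomial_self: "qbinomial p n n = 1"
  by (induction n) (simp_all add: qbinomial_eq_0)

definition qfact :: "complex \<Rightarrow> nat \<Rightarrow> complex" where
  "qfact p n = (\<Prod>j<n. 1 - p * p ^ j)"

lemma qbinomial_qfact:
  "k \<le> n \<Longrightarrow> qbinomial p n k * qfact p k * qfact p (n - k) = qfact p n"
proof (induction p n k rule: qbinomial.induct)
  case (1 p n)
  show ?case by (simp add: qfact_def)
next
  case (3 p n k)
  show ?case
  \<comment> \<open>The second induction hypothesis requires \<open>Suc k \<le> n\<close>, so the
    boundary case is done by hand.\<close>
  proof (cases "k = n")
    case True
    then show ?thesis
      unfolding True qbinomial_self by (simp add: qfact_def)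
  next
    case False
    then have k: "Suc k \<le> n" using 3 by simp
    then obtain d where n: "n = Suc (k + d)"
      by (metis add_Suc le_iff_add)
    let ?a = "qbinomial p n k" and ?b = "qbinomial p n (Suc k)"
    have a: "?a * qfact p k * qfact p (Suc d) = qfact p n"
      using 3(1) 3(3) k by (simp add: n)
    have b: "?b * qfact p (Suc k) * qfact p d = qfact p n"
      using 3(2) k by (simp add: n)
    have "qbinomial p (Suc n) (Suc k) * qfact p (Suc k) * qfact p (Suc n - Suc k)
        = ?a * qfact p k * qfact p (Suc d) * (1 - p * p ^ k)
          + p ^ Suc k * (?b * qfact p (Suc k) * qfact p d) * (1 - p * p ^ d)"
      by (simp add: n qfact_def algebra_simps)
    also have "\<dots> = qfact p n * (1 - p * p ^ k + p ^ Suc k * (1 - p * p ^ d))"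
      unfolding a b by (simp add: algebra_simps)
    also have "\<dots> = qfact p (Suc n)"
      by (simp add: n qfact_def algebra_simps power_add)
    finally show ?thesis .
  qed
qed auto

text \<open>Splitting off the factor j = 0 replaces z by zp in the remaining product, hence the
  induction over arbitrary z. Comparing coefficients is then the q-Pascal rule.\<close>

theorem q_binomial_theorem:
  "(\<Prod>j<n. 1 - z * p ^ j) = (\<Sum>k\<le>n. (- 1) ^ k * p ^ (k choose 2) * qbinomial p n k * z ^ k)"
proof (induction n arbitrary: z)
  case (Suc n)
  let ?t = "\<lambda>k. (- 1) ^ k * p ^ (k choose 2) * qbinomial p n k * (z * p) ^ k"
  have ch: "Suc k choose 2 = (k choose 2) + k" for k
    by (simp add: numeral_2_eq_2)
  have "(\<Prod>j<Suc n. 1 - z * p ^ j) = (1 - z) * (\<Prod>j<n. 1 - (z * p) * p ^ j)"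
    by (simp add: prod.lessThan_Suc_shift mult.assoc del: prod.lessThan_Suc)
  also have "\<dots> = (\<Sum>k\<le>n. ?t k) - z * (\<Sum>k\<le>n. ?t k)"
    by (simp only: Suc.IH left_diff_distrib mult_1)
  also have "(\<Sum>k\<le>n. ?t k) = 1 + (\<Sum>k\<le>n. ?t (Suc k))" (is "?S = ?S'")
  proof -
    have "(\<Sum>k\<le>n. ?t k) = (\<Sum>k\<le>Suc n. ?t k)"
      by (simp add: qbinomial_eq_0)
    also have "\<dots> = 1 + (\<Sum>k\<le>n. ?t (Suc k))"
      by (subst sum.atMost_Suc_shift) (simp add: numeral_2_eq_2)
    finally show ?thesis .
  qed
  then have "?S - z * ?S = ?S' - z * ?S"
    by simp
  also have "1 + (\<Sum>k\<le>n. ?t (Suc k)) - z * (\<Sum>k\<le>n. ?t k) = 1 + (\<Sum>k\<le>n. ?t (Suc k) - z * ?t k)"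
    by (simp add: sum_subtractf sum_distrib_left)
  also have "\<dots> = 1 + (\<Sum>k\<le>n. (- 1) ^ Suc k * p ^ (Suc k choose 2) * qbinomial p (Suc n) (Suc k) * z ^ Suc k)"
    by (intro arg_cong2[of _ _ _ _ "(+)"] sum.cong refl)
       (simp add: ch power_add power_mult_distrib algebra_simps)
  also have "\<dots> = (\<Sum>k\<le>Suc n. (- 1) ^ k * p ^ (k choose 2) * qbinomial p (Suc n) k * z ^ k)"
    by (subst sum.atMost_Suc_shift) (simp add: numeral_2_eq_2)
  finally show ?case .
qed (simp add: numeral_2_eq_2)

text \<open>The binomial coefficient "j choose 2" continued to negative j.\<close>

definition tri :: "int \<Rightarrow> int" where
  "tri j = j * (j - 1) div 2"

lemma two_tri: "2 * tri j = j * (j - 1)"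
  by (simp add: tri_def)

lemma tri_eqI: "2 * a = j * (j - 1) \<Longrightarrow> tri j = a"
  by (simp add: tri_def)

lemma tri_of_nat: "tri (int n) = int (n choose 2)"
proof (induction n)
  case (Suc n)
  then show ?case
    using two_tri[of "int n"] by (intro tri_eqI) (simp add: numeral_2_eq_2 algebra_simps)
qed (simp add: tri_def numeral_2_eq_2)

definition theta_term :: "complex \<Rightarrow> complex \<Rightarrow> int \<Rightarrow> complex" where
  "theta_term p x j = (- 1) powi j * p powi tri j * x powi j"

lemma prod_lessThan_add: "(\<Prod>j<m + n. f j) = (\<Prod>j<m. f j) * (\<Prod>j<n. f (m + j))"
  for f :: "nat \<Rightarrow> 'a::comm_monoid_mult"
  by (induction n) (simp_all add: mult.assoc)

text \<open>This is the q-binomial theorem with 2N factors at x / p^N, with the summation index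
  shifted by N. The first N factors, read backwards, become the factors in p/x after extracting the
  monomial c.\<close>

lemma finite_jacobi_triple_product:
  assumes "p \<noteq> 0" "x \<noteq> 0"
  shows "(\<Prod>i<N. 1 - x * p ^ i) * (\<Prod>i<N. 1 - p / x * p ^ i) =
    (\<Sum>j\<in>{- int N..int N}. qbinomial p (2 * N) (nat (j + int N)) * theta_term p x j)"
proof -
  \<comment> \<open>c is the product of -x / p^(i+1) over i < N, the monomials extracted from the
    reversed factors.\<close>
  define c where "c = (- x) ^ N / p ^ (Suc N choose 2)"
  have c0: "c \<noteq> 0" using assms by (simp add: c_def)
  have "(\<Prod>j<N. 1 - x / p ^ N * p ^ j) = (\<Prod>i<N. 1 - x / p ^ N * p ^ (N - Suc i))"
    by (rule prod.nat_diff_reindex[symmetric])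
  also have "\<dots> = (\<Prod>i<N. (- x / p ^ Suc i) * (1 - p / x * p ^ i))"
  proof (rule prod.cong[OF refl])
    fix i assume "i \<in> {..<N}"
    then have "p ^ N = p ^ (N - Suc i) * p ^ Suc i"
      by (simp add: power_add[symmetric] del: power_Suc)
    then show "1 - x / p ^ N * p ^ (N - Suc i) = (- x / p ^ Suc i) * (1 - p / x * p ^ i)"
      using assms by (simp add: field_simps)
  qed
  also have "\<dots> = (\<Prod>i<N. - x / p ^ Suc i) * (\<Prod>i<N. 1 - p / x * p ^ i)"
    by (rule prod.distrib)
  also have "(\<Prod>i<N. - x / p ^ Suc i) = c"
    unfolding c_def using assms
    by (induction N) (simp_all add: numeral_2_eq_2 power_add field_simps)
  finally have "c * ((\<Prod>i<N. 1 - x * p ^ i) * (\<Prod>i<N. 1 - p / x * p ^ i))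
      = (\<Prod>j<N + N. 1 - x / p ^ N * p ^ j)"
    using assms by (simp add: prod_lessThan_add power_add mult_ac)
  also have "\<dots> = (\<Sum>k\<le>N + N. (- 1) ^ k * p ^ (k choose 2) * qbinomial p (N + N) k * (x / p ^ N) ^ k)"
    by (rule q_binomial_theorem)
  also have "\<dots> = (\<Sum>j\<in>{- int N..int N}. c * (qbinomial p (2 * N) (nat (j + int N)) * theta_term p x j))"
  proof (rule sum.reindex_bij_witness[of _ "\<lambda>j. nat (j + int N)" "\<lambda>k. int k - int N"], goal_cases)
    case (5 k)
    have t: "tri (int k - int N) = int (k choose 2) + int (Suc N choose 2) - int N * int k"
      using two_tri[of "int k"] two_tri[of "int (Suc N)"]
      by (intro tri_eqI) (simp add: tri_of_nat[symmetric] algebra_simps)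
    have m: "(- 1 :: complex) powi (int k - int N) = (- 1) ^ k * (- 1) ^ N"
      by (simp add: power_int_diff uminus_power_if)
    have "c * theta_term p x (int k - int N) = (- 1) ^ k * p ^ (k choose 2) * (x / p ^ N) ^ k"
      using assms
      by (simp add: theta_term_def c_def t m power_int_diff power_int_add power_divide
          power_mult[symmetric] power_minus[of x] del: of_nat_mult of_nat_Suc)
         (simp add: field_simps flip: power_mult_distrib of_nat_mult)
    then show ?case
      by (simp add: mult_2 mult_2_right mult_ac)
  qed auto
  finally show ?thesis
    using c0 by (simp add: sum_distrib_left[symmetric])
qed

section \<open>Absolute convergence of the bilateral theta series\<close>

text \<open>Pairing k with -k-1 turns a sum over the integers into an ordinary series, the form in
  which dominated convergence is applied later.\<close>

lemma has_sum_int_split: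
  fixes f :: "int \<Rightarrow> 'a::banach"
  assumes "summable (\<lambda>k. norm (f (int k)))" "summable (\<lambda>k. norm (f (- int k - 1)))"
  shows "(f has_sum (\<Sum>k. f (int k) + f (- int k - 1))) UNIV"
proof -
  have "((f \<circ> int) has_sum (\<Sum>k. f (int k))) UNIV"
    using assms(1) unfolding o_def
    by (intro norm_summable_imp_has_sum) (auto intro: summable_norm_cancel summable_sums)
  moreover have "range int = {0..}"
    by (auto simp: image_iff intro: zero_le_imp_eq_int)
  ultimately have 1: "(f has_sum (\<Sum>k. f (int k))) {0..}"
    using has_sum_reindex[of int UNIV f] by simp
  have "((f \<circ> (\<lambda>k. - int k - 1)) has_sum (\<Sum>k. f (- int k - 1))) UNIV"
    using assms(2) unfolding o_def
    by (intro norm_summable_imp_has_sum) (auto intro: summable_norm_cancel summable_sums)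
  moreover have "range (\<lambda>k. - int k - 1) = {..<0}"
  proof (intro equalityI subsetI)
    fix j :: int assume "j \<in> {..<0}"
    then have "j = - int (nat (- j - 1)) - 1" by simp
    then show "j \<in> range (\<lambda>k. - int k - 1)" by blast
  qed auto
  ultimately have 2: "(f has_sum (\<Sum>k. f (- int k - 1))) {..<0}"
    using has_sum_reindex[of "\<lambda>k. - int k - 1" UNIV f] by (simp add: inj_on_def)
  have "{0..} \<inter> {..<0} = ({} :: int set)" "{0..} \<union> {..<0} = (UNIV :: int set)" by auto
  moreover have "(\<Sum>k. f (int k)) + (\<Sum>k. f (- int k - 1)) = (\<Sum>k. f (int k) + f (- int k - 1))"
    using assms by (intro suminf_add) (auto simp: summable_norm_cancel)
  ultimately show ?thesis
    using has_sum_Un_disjoint[OF 1 2] by simp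
qed

text \<open>The quotient of consecutive terms is r^k R, which tends to 0 however large R is.\<close>

lemma summable_square_power:
  fixes r R :: real
  assumes "0 < r" "r < 1" "0 < R"
  shows "summable (\<lambda>k. r ^ (k choose 2) * R ^ k)"
proof -
  have "(\<lambda>k. r ^ k * R) \<longlonglongrightarrow> 0 * R"
    using assms by (intro tendsto_intros LIMSEQ_power_zero) auto
  then have "eventually (\<lambda>k. r ^ k * R < 1 / 2) sequentially"
    by (intro order_tendstoD(2)[where y = 0]) auto
  then obtain N where N: "\<And>k. k \<ge> N \<Longrightarrow> r ^ k * R < 1 / 2"
    by (auto simp: eventually_sequentially)
  show ?thesis
  proof (rule summable_ratio_test)
    fix k assume "k \<ge> N"
    then have "r ^ k * R * (r ^ (k choose 2) * R ^ k) \<le> 1 / 2 * (r ^ (k choose 2) * R ^ k)"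
      using N[of k] assms by (intro mult_right_mono) auto
    then show "norm (r ^ (Suc k choose 2) * R ^ Suc k) \<le> 1 / 2 * norm (r ^ (k choose 2) * R ^ k)"
      using assms by (simp add: numeral_2_eq_2 power_add mult_ac)
  qed simp
qed

text \<open>The exponent \<open>tri\<close> is symmetric about 1/2. This reduces summability over
  negative indices to that over nonnegative ones at 1/x.\<close>

lemma theta_term_reflect:
  assumes "x \<noteq> 0"
  shows "theta_term p x (1 - j) = - x * theta_term p (1 / x) j"
proof -
  have "tri (1 - j) = tri j"
    by (simp add: tri_def mult.commute algebra_simps)
  moreover have "(- 1 :: complex) powi (1 - j) = - ((- 1) powi j)"
    by (simp add: power_int_diff power_int_minus_left)
  ultimately show ?thesis
    using assms by (simp add: theta_term_def power_int_diff power_int_one_over field_simps)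
qed

lemma norm_theta_term_of_nat: "norm (theta_term p x (int k)) = norm p ^ (k choose 2) * norm x ^ k"
  by (simp add: theta_term_def tri_of_nat norm_mult norm_power)

lemma summable_theta_term:
  assumes "p \<noteq> 0" "norm p < 1" "x \<noteq> 0"
  shows "summable (\<lambda>k. norm (theta_term p x (int k)))"
    and "summable (\<lambda>k. norm (theta_term p x (- int k - 1)))"
proof -
  have *: "summable (\<lambda>k. norm (theta_term p y (int k)))" if "y \<noteq> 0" for y
    unfolding norm_theta_term_of_nat using assms that by (intro summable_square_power) auto
  from *[OF assms(3)] show "summable (\<lambda>k. norm (theta_term p x (int k)))" .
  have "summable (\<lambda>k. norm x * norm (theta_term p (1 / x) (int (k + 2))))"
    using assms by (intro summable_mult summable_ignore_initial_segment[OF *]) auto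
  moreover have "norm (theta_term p x (- int k - 1)) = norm x * norm (theta_term p (1 / x) (int (k + 2)))" for k
  proof -
    have "1 - int (k + 2) = - int k - 1" by simp
    from theta_term_reflect[OF assms(3), of p "int (k + 2)", unfolded this] show ?thesis
      by (simp add: norm_mult)
  qed
  ultimately show "summable (\<lambda>k. norm (theta_term p x (- int k - 1)))"
    by simp
qed

lemma theta_term_has_sum:
  assumes "p \<noteq> 0" "norm p < 1" "x \<noteq> 0"
  shows "(theta_term p x has_sum (\<Sum>k. theta_term p x (int k) + theta_term p x (- int k - 1))) UNIV"
    and "(\<lambda>j. norm (theta_term p x j)) summable_on UNIV"
proof -
  show "(theta_term p x has_sum (\<Sum>k. theta_term p x (int k) + theta_term p x (- int k - 1))) UNIV"
    by (intro has_sum_int_split summable_theta_term assms)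
  have "((\<lambda>j. norm (theta_term p x j)) has_sum
      (\<Sum>k. norm (theta_term p x (int k)) + norm (theta_term p x (- int k - 1)))) UNIV"
    using summable_theta_term[OF assms] by (intro has_sum_int_split) auto
  then show "(\<lambda>j. norm (theta_term p x j)) summable_on UNIV"
    by (rule has_sum_imp_summable)
qed

section \<open>Passage to the limit in the finite triple product\<close>

lemma qfact_tendsto: "norm p < 1 \<Longrightarrow> qfact p \<longlonglongrightarrow> qprod p p"
  unfolding qfact_def[abs_def] by (rule qprod_tendsto)

lemma qfact_neq_0:
  assumes "norm p < 1"
  shows "qfact p n \<noteq> 0"
proof -
  have "p * p ^ j \<noteq> 1" for j
    using power_less_one_iff[of "norm p" "Suc j"] assms
    by (metis less_irrefl norm_ge_zero norm_one norm_power power_Suc zero_less_Suc)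
  then show ?thesis by (auto simp: qfact_def)
qed

lemma central_qbinomial_eq:
  assumes "norm p < 1" "m + m' = 2 * N"
  shows "qbinomial p (2 * N) m = qfact p (2 * N) / (qfact p m * qfact p m')"
proof -
  have "qbinomial p (2 * N) m * qfact p m * qfact p m' = qfact p (2 * N)"
    using qbinomial_qfact[of m "2 * N" p] assms(2) by (metis diff_add_inverse le_add1)
  then show ?thesis
    using qfact_neq_0[OF assms(1)] by (simp add: field_simps)
qed

text \<open>The sequence \<open>qfact p\<close> converges to a nonzero limit, so it and its
  reciprocals are bounded. The bound is the dominating constant in the triple product.\<close>

lemma central_qbinomial_bound:
  assumes "norm p < 1"
  obtains M where "\<And>N m. m \<le> 2 * N \<Longrightarrow> norm (qbinomial p (2 * N) m) \<le> M"
proof -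
  have Q: "qprod p p \<noteq> 0"
    using assms by (intro qprod_neq_0)
  have "Bseq (qfact p)" "Bseq (\<lambda>n. inverse (qfact p n))"
    using convergentI[OF qfact_tendsto[OF assms]]
      convergentI[OF tendsto_inverse[OF qfact_tendsto[OF assms] Q]]
    by (simp_all add: convergent_imp_Bseq)
  then obtain K L where K: "\<And>n. norm (qfact p n) \<le> K" and L: "\<And>n. norm (inverse (qfact p n)) \<le> L"
    unfolding Bseq_def by blast
  have K0: "0 \<le> K" and L0: "0 \<le> L"
    using order_trans[OF norm_ge_zero K] order_trans[OF norm_ge_zero L] by auto
  have "norm (qbinomial p (2 * N) m) \<le> K * (L * L)" if "m \<le> 2 * N" for N m
  proof -
    have "qbinomial p (2 * N) m =
        qfact p (2 * N) * (inverse (qfact p m) * inverse (qfact p (2 * N - m)))"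
      using central_qbinomial_eq[OF assms, of m "2 * N - m" N] that by (simp add: field_simps)
    then show ?thesis
      using K[of "2 * N"] L[of m] L[of "2 * N - m"] K0 L0 by (simp add: norm_mult mult_mono)
  qed
  then show ?thesis by (rule that)
qed

lemma central_qbinomial_tendsto:
  assumes "norm p < 1"
  shows "(\<lambda>N. qbinomial p (2 * N) (nat (j + int N))) \<longlonglongrightarrow> 1 / qprod p p"
proof -
  have Q: "qprod p p \<noteq> 0"
    using assms by (intro qprod_neq_0)
  have lim: "filterlim (\<lambda>N. nat (i + int N)) at_top sequentially" for i
  proof (rule filterlim_at_top_mono[of "\<lambda>N. N - nat (- i)"])
    show "filterlim (\<lambda>N. N - nat (- i)) at_top sequentially"
      by (rule filterlim_minus_const_nat_at_top)
  qed (auto intro!: always_eventually)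
  have "(\<lambda>N. qfact p (2 * N) / (qfact p (nat (j + int N)) * qfact p (nat (- j + int N))))
      \<longlonglongrightarrow> qprod p p / (qprod p p * qprod p p)"
    using Q
    by (intro tendsto_intros filterlim_compose[OF qfact_tendsto[OF assms]] lim)
       (auto simp: mult_nat_left_at_top)
  moreover have "eventually (\<lambda>N. qfact p (2 * N) / (qfact p (nat (j + int N)) * qfact p (nat (- j + int N)))
      = qbinomial p (2 * N) (nat (j + int N))) sequentially"
    using eventually_ge_at_top[of "nat \<bar>j\<bar>"]
  proof eventually_elim
    case (elim N)
    then show ?case
      by (intro central_qbinomial_eq[symmetric] assms) linarith
  qed
  ultimately show ?thesis
    using Q by (simp add: Lim_transform_eventually)
qed

text \<open>In the finite identity the coefficient of each theta term tends to
  \<open>1 / qprod p p\<close> and is uniformly bounded, so Tannery's theorem gives the limit of the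
  whole sum.\<close>

theorem jacobi_triple_product:
  assumes "p \<noteq> 0" "norm p < 1" "x \<noteq> 0"
  shows "(theta_term p x has_sum qprod p p * theta x p) UNIV"
proof -
  let ?t = "theta_term p x"
  have Q: "qprod p p \<noteq> 0"
    using assms by (intro qprod_neq_0)
  obtain M where M: "\<And>N m. m \<le> 2 * N \<Longrightarrow> norm (qbinomial p (2 * N) m) \<le> M"
    using central_qbinomial_bound[OF assms(2)] by blast
  have M0: "0 \<le> M"
    using order_trans[OF norm_ge_zero M[of 0 0]] by simp
  \<comment> \<open>The cutoff makes each finite sum a series over all k. Below -N it is essential:
    \<open>nat\<close> would send these j to index 0, where the coefficient is 1.\<close>
  define c where "c N j = (if \<bar>j\<bar> \<le> int N then qbinomial p (2 * N) (nat (j + int N)) else 0)" for N j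
  have c_le: "norm (c N j) \<le> M" for N j
    using M[of "nat (j + int N)" N] M0 by (auto simp: c_def)
  have c_lim: "(\<lambda>N. c N j) \<longlonglongrightarrow> 1 / qprod p p" for j
  proof (rule Lim_transform_eventually[OF central_qbinomial_tendsto[OF assms(2)]])
    show "eventually (\<lambda>N. qbinomial p (2 * N) (nat (j + int N)) = c N j) sequentially"
      using eventually_ge_at_top[of "nat \<bar>j\<bar>"]
      by eventually_elim (auto simp: c_def)
  qed
  define a where "a k N = c N (int k) * ?t (int k) + c N (- int k - 1) * ?t (- int k - 1)" for k N
  define b where "b k = 1 / qprod p p * ?t (int k) + 1 / qprod p p * ?t (- int k - 1)" for k
  have "(\<lambda>N. \<Sum>k. a k N) \<longlonglongrightarrow> suminf b"
  proof (rule tannerys_theorem[THEN conjunct2, THEN conjunct2])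
    show "(\<lambda>N. a k N) \<longlonglongrightarrow> b k" for k
      unfolding a_def b_def by (intro tendsto_intros c_lim)
    show "summable (\<lambda>k. M * (norm (?t (int k)) + norm (?t (- int k - 1))))"
      by (intro summable_mult summable_add summable_theta_term assms)
    have "norm (a k N) \<le> M * (norm (?t (int k)) + norm (?t (- int k - 1)))" for k N
      unfolding a_def distrib_left
      by (intro order_trans[OF norm_triangle_ineq] add_mono) (auto simp: norm_mult intro!: mult_right_mono c_le)
    then show "eventually (\<lambda>(k, N). norm (a k N) \<le> M * (norm (?t (int k)) + norm (?t (- int k - 1))))
        (at_top \<times>\<^sub>F sequentially)"
      by (intro always_eventually) auto
  qed simp
  moreover have "(\<Sum>k. a k N) = (\<Prod>i<N. 1 - x * p ^ i) * (\<Prod>i<N. 1 - p / x * p ^ i)" for N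
  proof -
    have "(\<Sum>k. a k N) = (\<Sum>k\<le>N. a k N)"
      by (rule suminf_finite) (auto simp: a_def c_def)
    \<comment> \<open>The negative half ends one step earlier, because k = N would give the index
      -N-1, which is cut off.\<close>
    also have "\<dots> = (\<Sum>k\<le>N. c N (int k) * ?t (int k)) + (\<Sum>k<N. c N (- int k - 1) * ?t (- int k - 1))"
      by (simp add: a_def sum.distrib c_def flip: lessThan_Suc_atMost)
    also have "(\<Sum>k\<le>N. c N (int k) * ?t (int k)) = (\<Sum>j\<in>{0..int N}. c N j * ?t j)"
      by (rule sum.reindex_bij_witness[of _ nat int]) auto
    also have "(\<Sum>k<N. c N (- int k - 1) * ?t (- int k - 1)) = (\<Sum>j\<in>{- int N..<0}. c N j * ?t j)"
      by (rule sum.reindex_bij_witness[of _ "\<lambda>j. nat (- j - 1)" "\<lambda>k. - int k - 1"]) auto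
    also have "(\<Sum>j\<in>{0..int N}. c N j * ?t j) + (\<Sum>j\<in>{- int N..<0}. c N j * ?t j)
        = (\<Sum>j\<in>{0..int N} \<union> {- int N..<0}. c N j * ?t j)"
      by (rule sum.union_disjoint[symmetric]) auto
    also have "{0..int N} \<union> {- int N..<0} = {- int N..int N}"
      by auto
    also have "(\<Sum>j\<in>{- int N..int N}. c N j * ?t j)
        = (\<Sum>j\<in>{- int N..int N}. qbinomial p (2 * N) (nat (j + int N)) * ?t j)"
      by (rule sum.cong) (auto simp: c_def)
    also have "\<dots> = (\<Prod>i<N. 1 - x * p ^ i) * (\<Prod>i<N. 1 - p / x * p ^ i)"
      using assms by (intro finite_jacobi_triple_product[symmetric])
    finally show ?thesis .
  qed
  moreover have "(\<lambda>N. (\<Prod>i<N. 1 - x * p ^ i) * (\<Prod>i<N. 1 - p / x * p ^ i)) \<longlonglongrightarrow> theta x p"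
    unfolding theta_def by (intro tendsto_intros qprod_tendsto assms)
  ultimately have "suminf b = theta x p"
    by (simp add: LIMSEQ_unique)
  moreover have "suminf b = 1 / qprod p p * (\<Sum>k. ?t (int k) + ?t (- int k - 1))"
    unfolding b_def distrib_left[symmetric]
    using summable_theta_term[OF assms] by (intro suminf_mult summable_add) (auto intro: summable_norm_cancel)
  ultimately have "theta x p = 1 / qprod p p * (\<Sum>k. ?t (int k) + ?t (- int k - 1))"
    by simp
  then have "qprod p p * theta x p = (\<Sum>k. ?t (int k) + ?t (- int k - 1))"
    using Q by simp
  then show ?thesis
    using theta_term_has_sum(1)[OF assms] by simp
qed

section \<open>Products of two theta functions\<close>

lemma summable_on_product:
  fixes a :: "'a \<Rightarrow> 'c::{real_normed_div_algebra, banach}"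
  assumes "(\<lambda>x. norm (a x)) summable_on A" "(\<lambda>y. norm (b y)) summable_on B"
  shows "(\<lambda>(x, y). a x * b y) summable_on A \<times> B"
proof -
  have "(\<lambda>z. norm ((\<lambda>(x, y). a x * b y) z)) summable_on A \<times> B"
  proof (rule summable_on_SigmaI)
    show "((\<lambda>y. norm ((\<lambda>(x, y). a x * b y) (x, y))) has_sum norm (a x) * infsum (\<lambda>y. norm (b y)) B) B"
      for x
      using has_sum_cmult_right[OF has_sum_infsum[OF assms(2)], of "norm (a x)"] by (simp add: norm_mult)
    show "(\<lambda>x. norm (a x) * infsum (\<lambda>y. norm (b y)) B) summable_on A"
      by (intro summable_on_cmult_left assms(1))
  qed simp
  then show ?thesis by (rule abs_summable_summable)
qed

lemma infsum_product:
  fixes a :: "'a \<Rightarrow> 'c::{real_normed_div_algebra, banach}"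
  assumes "(\<lambda>(x, y). a x * b y) summable_on A \<times> B"
  shows "infsum (\<lambda>(x, y). a x * b y) (A \<times> B) = infsum a A * infsum b B"
  using infsum_Sigma'_banach[OF assms] by (simp add: infsum_cmult_right' infsum_cmult_left')

text \<open>Pairs with even sum are (i+j, i-j) and those with odd sum are (i+j+1, i-j), each in
  exactly one way. This change of variables diagonalises the exponents in a product of two theta
  series.\<close>

lemma infsum_int_pairs_by_parity:
  fixes F :: "int \<times> int \<Rightarrow> 'a::banach"
  assumes "F summable_on UNIV"
  shows "(\<lambda>(i, j). F (i + j, i - j)) summable_on UNIV"
    and "(\<lambda>(i, j). F (i + j + 1, i - j)) summable_on UNIV"
    and "infsum F UNIV = infsum (\<lambda>(i, j). F (i + j, i - j)) UNIV + infsum (\<lambda>(i, j). F (i + j + 1, i - j)) UNIV"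
proof -
  define d :: "int \<times> int \<Rightarrow> int \<times> int" where "d = (\<lambda>(i, j). (i + j, i - j))"
  define e :: "int \<times> int \<Rightarrow> int \<times> int" where "e = (\<lambda>(i, j). (i + j + 1, i - j))"
  have inj: "inj d" "inj e"
    by (auto simp: d_def e_def inj_on_def)
  have Fd: "F \<circ> d = (\<lambda>(i, j). F (i + j, i - j))" and Fe: "F \<circ> e = (\<lambda>(i, j). F (i + j + 1, i - j))"
    by (auto simp: d_def e_def)
  have sd: "F summable_on range d" and se: "F summable_on range e"
    using assms by (auto intro: summable_on_subset_banach)
  show "(\<lambda>(i, j). F (i + j, i - j)) summable_on UNIV" "(\<lambda>(i, j). F (i + j + 1, i - j)) summable_on UNIV"
    using sd se summable_on_reindex[OF inj(1), of F] summable_on_reindex[OF inj(2), of F]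
    unfolding Fd Fe by auto
  have "range d \<inter> range e = {}"
  proof (rule ccontr)
    assume "range d \<inter> range e \<noteq> {}"
    then obtain i j k l :: int where "i + j = k + l + 1" "i - j = k - l"
      by (auto simp: d_def e_def)
    then show False by presburger
  qed
  moreover have "range d \<union> range e = UNIV"
  proof (intro equalityI subsetI UNIV_I)
    fix z :: "int \<times> int"
    obtain m n where z: "z = (m, n)" by (cases z)
    show "z \<in> range d \<union> range e"
    proof (cases "even (m + n)")
      case True
      then obtain k where "m + n = 2 * k" by blast
      then have "z = d (k, m - k)" by (simp add: z d_def)
      then show ?thesis by blast
    next
      case False
      then obtain k where "m + n = 2 * k + 1" by (rule oddE)
      then have "z = e (k, m - k - 1)" by (simp add: z e_def)
      then show ?thesis by blast
    qed
  qed
  ultimately show "infsum F UNIV = infsum (\<lambda>(i, j). F (i + j, i - j)) UNIV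
      + infsum (\<lambda>(i, j). F (i + j + 1, i - j)) UNIV"
    using infsum_Un_disjoint[OF sd se] infsum_reindex[OF inj(1), of F] infsum_reindex[OF inj(2), of F]
    unfolding Fd Fe by simp
qed

text \<open>With x = exp(iz) this is the classical theta_3(z) of nome p, and
  \<open>theta_odd\<close> is p^(-1/4) theta_2(z). The names refer to the parity of the powers of
  x.\<close>

definition theta_even :: "complex \<Rightarrow> complex \<Rightarrow> complex" where
  "theta_even p x = (\<Sum>\<^sub>\<infinity>n::int. p powi (n * n) * x powi (2 * n))"

definition theta_odd :: "complex \<Rightarrow> complex \<Rightarrow> complex" where
  "theta_odd p x = (\<Sum>\<^sub>\<infinity>n::int. p powi (n * n + n) * x powi (2 * n + 1))"

text \<open>The theta functions \<open>x \<mapsto> theta (x y) theta (x / y)\<close> of degree two span a plane, so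
  each of them is a 2-by-2 determinant of coordinate vectors.\<close>

lemma theta_mult_theta:
  assumes "p \<noteq> 0" "norm p < 1" "x \<noteq> 0" "y \<noteq> 0"
  shows "(qprod p p)^2 * (theta (x * y) p * theta (x / y) p) =
    x * (theta_odd p x * theta_even p y - theta_even p x * theta_odd p y)"
proof -
  define F where "F = (\<lambda>(m, n). theta_term p (x * y) m * theta_term p (x / y) n)"
  have sF: "F summable_on UNIV"
    using summable_on_product[OF theta_term_has_sum(2) theta_term_has_sum(2), of p "x * y" p "x / y"] assms
    by (simp add: F_def)
  have "infsum F UNIV = infsum (theta_term p (x * y)) UNIV * infsum (theta_term p (x / y)) UNIV"
    using infsum_product[of "theta_term p (x * y)" "theta_term p (x / y)" UNIV UNIV] sF
    by (simp add: F_def)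
  then have L: "infsum F UNIV = (qprod p p)^2 * (theta (x * y) p * theta (x / y) p)"
    using infsumI[OF jacobi_triple_product[of p "x * y"]] infsumI[OF jacobi_triple_product[of p "x / y"]] assms
    by (simp add: power2_eq_square)
  note parity = infsum_int_pairs_by_parity[OF sF]
  \<comment> \<open>In the new variables the exponent of p is a function of i plus a function of j,
    so each parity class factors. The sign (-1)^(m+n) is constant on each class, which produces the
    determinant.\<close>
  have t0: "tri (i + j) + tri (i - j) = (i * i - i) + j * j" for i j
    using two_tri[of "i + j"] two_tri[of "i - j"] by (simp add: algebra_simps)
  have t1: "tri (i + j + 1) + tri (i - j) = i * i + (j * j + j)" for i j
    using two_tri[of "i + j + 1"] two_tri[of "i - j"] by (simp add: algebra_simps)
  have F: "F (m, n) = (- 1) powi (m + n) * p powi (tri m + tri n) * (x powi (m + n) * y powi (m - n))" for m n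
    using assms
    by (simp add: F_def theta_term_def power_int_mult_distrib power_int_divide_distrib
        power_int_add power_int_diff)
  have sign: "(- 1 :: complex) powi (2 * i) = 1" for i
    by (simp add: power_int_mult)
  have F0: "F (i + j, i - j) = (p powi (i * i - i) * x powi (2 * i)) * (p powi (j * j) * y powi (2 * j))" for i j
  proof -
    have "i + j + (i - j) = 2 * i" "i + j - (i - j) = 2 * j" by simp_all
    then show ?thesis
      using assms by (simp add: F t0 sign power_int_add[of p])
  qed
  have F1: "F (i + j + 1, i - j) =
      - ((x * (p powi (i * i) * x powi (2 * i))) * (p powi (j * j + j) * y powi (2 * j + 1)))" for i j
  proof -
    have "i + j + 1 + (i - j) = 2 * i + 1" "i + j + 1 - (i - j) = 2 * j + 1" by simp_all
    moreover have "x powi (2 * i + 1) = x powi (2 * i) * x" "(- 1 :: complex) powi (2 * i + 1) = - 1"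
      using assms sign by (simp_all add: power_int_add)
    ultimately show ?thesis
      using assms by (simp add: F t1 power_int_add[of p])
  qed
  have "infsum (\<lambda>(i, j). F (i + j, i - j)) UNIV =
      (\<Sum>\<^sub>\<infinity>i. p powi (i * i - i) * x powi (2 * i)) * theta_even p y"
    using infsum_product[of "\<lambda>i. p powi (i * i - i) * x powi (2 * i)" "\<lambda>j. p powi (j * j) * y powi (2 * j)" UNIV UNIV]
      parity(1) unfolding F0 theta_even_def by simp
  moreover have "(\<Sum>\<^sub>\<infinity>i. p powi (i * i - i) * x powi (2 * i)) = x * theta_odd p x"
  proof -
    have "bij (\<lambda>i::int. i + 1)"
      by (rule bij_plus_right)
    then have "(\<Sum>\<^sub>\<infinity>i. p powi (i * i - i) * x powi (2 * i)) =
        (\<Sum>\<^sub>\<infinity>i. p powi ((i + 1) * (i + 1) - (i + 1)) * x powi (2 * (i + 1)))"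
      by (rule infsum_reindex_bij_betw[symmetric])
    also have "\<dots> = (\<Sum>\<^sub>\<infinity>i. x * (p powi (i * i + i) * x powi (2 * i + 1)))"
      using assms by (intro infsum_cong) (simp add: power_int_add algebra_simps power2_eq_square)
    finally show ?thesis
      by (simp add: theta_odd_def infsum_cmult_right')
  qed
  moreover have "infsum (\<lambda>(i, j). F (i + j + 1, i - j)) UNIV = - (x * theta_even p x * theta_odd p y)"
  proof -
    have "(\<lambda>(i, j). (x * (p powi (i * i) * x powi (2 * i))) * (p powi (j * j + j) * y powi (2 * j + 1)))
        summable_on UNIV"
      using parity(2) unfolding F1 by (simp add: case_prod_unfold summable_on_uminus)
    then show ?thesis
      using infsum_product[of "\<lambda>i. x * (p powi (i * i) * x powi (2 * i))"
          "\<lambda>j. p powi (j * j + j) * y powi (2 * j + 1)" UNIV UNIV]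
      unfolding F1 theta_even_def theta_odd_def
      by (simp add: case_prod_unfold infsum_uminus infsum_cmult_right')
  qed
  ultimately have "infsum F UNIV = x * (theta_odd p x * theta_even p y - theta_even p x * theta_odd p y)"
    unfolding parity(3) by (simp add: algebra_simps)
  with L show ?thesis by simp
qed

section \<open>The Weierstrass cubic\<close>

text \<open>\<open>P\<close> is an affine image of the Weierstrass function, written in the multiplicative variable.\<close>

lemma theta_weierstrass:
  assumes "p \<noteq> 0" "norm p < 1"
  obtains P where "\<And>x y. \<lbrakk>x \<noteq> 0; y \<noteq> 0; theta x p \<noteq> 0; theta y p \<noteq> 0\<rbrakk> \<Longrightarrow>
    P x - P y = y * theta (x * y) p * theta (x / y) p / ((theta x p)^2 * (theta y p)^2)"
proof -
  define Q where "Q = (qprod p p)^2"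
  define D where "D x y = theta_odd p x * theta_even p y - theta_even p x * theta_odd p y" for x y
  have Q: "Q \<noteq> 0"
    using qprod_neq_0[OF assms(2) assms(2)] by (simp add: Q_def)
  have D: "Q * (theta (x * y) p * theta (x / y) p) = x * D x y" if "x \<noteq> 0" "y \<noteq> 0" for x y
    unfolding Q_def D_def using theta_mult_theta[OF assms that] .
  have D1: "Q * (theta x p)^2 = x * D x 1" if "x \<noteq> 0" for x
    using D[OF that, of 1] by (simp add: power2_eq_square)
  \<comment> \<open>\<open>D x y\<close> is the determinant of the coordinate vectors of x and y. L
    is a second linear coordinate next to \<open>D x 1\<close>, normalised so that the change of
    basis preserves determinants; P is then Q times the ratio of the two.\<close>
  obtain L where L: "\<And>x y. D x 1 \<noteq> 0 \<Longrightarrow> L x * D y 1 - L y * D x 1 = D x y"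
  proof (cases "theta_even p 1 = 0")
    case False
    show ?thesis
      by (rule that[of "\<lambda>x. - theta_even p x / theta_even p 1"])
         (use False in \<open>simp add: D_def field_simps\<close>)
  next
    case True
    show ?thesis
    proof (cases "theta_odd p 1 = 0")
      case False
      show ?thesis
        by (rule that[of "\<lambda>x. - theta_odd p x / theta_odd p 1"])
           (use False True in \<open>simp add: D_def field_simps\<close>)
    qed (use True that in \<open>simp add: D_def\<close>)
  qed
  show ?thesis
  proof (rule that[of "\<lambda>x. Q * L x / D x 1"])
    fix x y assume xy: "x \<noteq> 0" "y \<noteq> 0" "theta x p \<noteq> 0" "theta y p \<noteq> 0"
    then have nz: "D x 1 \<noteq> 0" "D y 1 \<noteq> 0"
      using D1[OF xy(1)] D1[OF xy(2)] Q by auto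
    have "Q * L x / D x 1 - Q * L y / D y 1 = Q * D x y / (D x 1 * D y 1)"
      unfolding L[OF nz(1), of y, symmetric] using nz by (simp add: field_simps)
    also have "\<dots> = y * (x * D x y / Q) / ((x * D x 1 / Q) * (y * D y 1 / Q))"
      using Q xy nz by (simp add: field_simps)
    also have "\<dots> = y * (theta (x * y) p * theta (x / y) p) / ((theta x p)^2 * (theta y p)^2)"
      using D[OF xy(1,2), symmetric] D1[OF xy(1), symmetric] D1[OF xy(2), symmetric] Q by simp
    finally show "Q * L x / D x 1 - Q * L y / D y 1
        = y * theta (x * y) p * theta (x / y) p / ((theta x p)^2 * (theta y p)^2)"
      by (simp add: mult.assoc)
  qed
qed

text \<open>The numbers -1, s, -s are the nontrivial half periods, so the first left side is the
  Weierstrass cubic at P x. Each factor is a multiple of a squared theta at x times a half period,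
  and duplication combines these. The second claim is the discriminant of the cubic.\<close>

lemma theta_weierstrass_cubic:
  assumes p: "p \<noteq> 0" "norm p < 1" and s: "s^2 = p"
    and P: "\<And>x y. \<lbrakk>x \<noteq> 0; y \<noteq> 0; theta x p \<noteq> 0; theta y p \<noteq> 0\<rbrakk> \<Longrightarrow>
      P x - P y = y * theta (x * y) p * theta (x / y) p / ((theta x p)^2 * (theta y p)^2)"
  shows "\<lbrakk>x \<noteq> 0; theta x p \<noteq> 0\<rbrakk> \<Longrightarrow> (P x - P (- 1)) * (P x - P s) * (P x - P (- s)) =
      - (x^2 * (theta (x^2) p)^2) / (4 * (theta x p)^8)"
    and "((P (- 1) - P s) * (P (- 1) - P (- s)) * (P s - P (- s)))^2 = p / 16"
proof -
  let ?t = "\<lambda>x. theta x p"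
  have s0: "s \<noteq> 0" using p s by auto
  have half: "?t (- 1) * ?t s * ?t (- s) = 2"
    using theta_half_periods[OF p(2,1) s] .
  then have nz: "?t (- 1) \<noteq> 0" "?t s \<noteq> 0" "?t (- s) \<noteq> 0" by auto
  \<comment> \<open>Since r^2 = p, the point x r is p (x / r), so quasi-periodicity makes theta at x
    r and at x / r proportional.\<close>
  have shift: "?t (x * r) = - (r / x * ?t (x / r))" if "x \<noteq> 0" "r \<noteq> 0" "r^2 = p" for x r
    using theta_nome_mult[OF p(2,1), of "x / r"] that(1,2) that(3)[symmetric]
    by (simp add: power2_eq_square field_simps)
  {
    fix x assume x: "x \<noteq> 0" "?t x \<noteq> 0"
    have e: "P x - P r = - x * (?t (x * r))^2 / ((?t x)^2 * (?t r)^2)"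
      if "r \<noteq> 0" "r^2 = p" "?t r \<noteq> 0" for r
      using P[OF x(1) that(1) x(2) that(3)] shift[OF x(1) that(1,2)] x that(1)
      by (simp add: power2_eq_square)
    \<comment> \<open>The half period -1 has square 1 rather than p; here x r and x / r
      coincide.\<close>
    have e1: "P x - P (- 1) = - ((?t (- x))^2) / ((?t x)^2 * (?t (- 1))^2)"
      using P[OF x(1) _ x(2) nz(1)] by (simp add: power2_eq_square)
    have e2: "P x - P s = - x * (?t (x * s))^2 / ((?t x)^2 * (?t s)^2)"
      using e s0 s nz by blast
    have e3: "P x - P (- s) = - x * (?t (- (x * s)))^2 / ((?t x)^2 * (?t (- s))^2)"
      using e[of "- s"] s0 s nz by simp
    have dup: "?t x * ?t (- x) * ?t (x * s) * ?t (- (x * s)) = ?t (x^2)"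
      using theta_duplication[OF p(2,1) x(1) s] .
    have "(P x - P (- 1)) * (P x - P s) * (P x - P (- s)) =
        - (x^2 * (?t x * ?t (- x) * ?t (x * s) * ?t (- (x * s)))^2) /
          ((?t (- 1) * ?t s * ?t (- s))^2 * (?t x)^8)"
    proof -
      have "(- Y1 / (U * H1)) * (- x * Y2 / (U * H2)) * (- x * Y3 / (U * H3)) =
          - (x^2 * (U * Y1 * Y2 * Y3)) / ((H1 * H2 * H3) * (U * U * U * U))"
        if "U \<noteq> 0" for U H1 H2 H3 Y1 Y2 Y3
        using that by (simp add: power2_eq_square mult_ac)
      from this[of "(?t x)^2" "(?t (- x))^2" "(?t (- 1))^2" "(?t (x * s))^2" "(?t s)^2"
          "(?t (- (x * s)))^2" "(?t (- s))^2"]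
      show ?thesis
        unfolding e1 e2 e3 power_mult_distrib using x by (simp flip: power_add)
    qed
    then show "(P x - P (- 1)) * (P x - P s) * (P x - P (- s)) = - (x^2 * (?t (x^2))^2) / (4 * (?t x)^8)"
      unfolding dup half by simp
  }
  have inv: "?t (1 / x) = - ?t x / x" if "x \<noteq> 0" for x
    using theta_inverse[OF p(2,1) that] .
  have d1: "P (- 1) - P s = (?t (- s))^2 / ((?t (- 1))^2 * (?t s)^2)"
    using P[of "- 1" s] inv[of "- s"] s0 nz by (simp add: power2_eq_square)
  have d2: "P (- 1) - P (- s) = (?t s)^2 / ((?t (- 1))^2 * (?t (- s))^2)"
    using P[of "- 1" "- s"] inv[of s] s0 nz by (simp add: power2_eq_square)
  have "?t (- p) = ?t (- 1)"
    using theta_nome_mult[OF p(2,1), of "- 1"] by simp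
  then have d3: "P s - P (- s) = - s * (?t (- 1))^2 / ((?t s)^2 * (?t (- s))^2)"
    using P[of s "- s"] s0 nz s by (simp add: power2_eq_square)
  have "(P (- 1) - P s) * (P (- 1) - P (- s)) * (P s - P (- s)) = - s / (?t (- 1) * ?t s * ?t (- s))^2"
  proof -
    have "H3 / (H1 * H2) * (H2 / (H1 * H3)) * (- s * H1 / (H2 * H3)) = - s / (H1 * H2 * H3)"
      if "H1 \<noteq> 0" "H2 \<noteq> 0" "H3 \<noteq> 0" for H1 H2 H3
      using that by simp
    from this[of "(?t (- 1))^2" "(?t s)^2" "(?t (- s))^2"] show ?thesis
      unfolding d1 d2 d3 power_mult_distrib using nz by simp
  qed
  then show "((P (- 1) - P s) * (P (- 1) - P (- s)) * (P s - P (- s)))^2 = p / 16"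
    unfolding half by (simp add: power_divide s)
qed

text \<open>A monic cubic is determined by its values at 0, 1 and A. Solving for its coefficients as
  functions of A and inserting them into the discriminant formula gives the claim.\<close>

lemma discriminant_by_interpolation:
  fixes A e1 e2 e3 :: complex
  assumes A: "A \<noteq> 0" "A \<noteq> 1"
    and R0: "(0 - e1) * (0 - e2) * (0 - e3) = A / (4 * (A - 1))"
    and R1: "(1 - e1) * (1 - e2) * (1 - e3) = (A - 1)^3 / (4 * A)"
    and RA: "(A - e1) * (A - e2) * (A - e3) = A^3 * (A - 1) / 4"
  shows "16 * ((e1 - e2) * (e1 - e3) * (e2 - e3))^2 = A * (A - 1) * (A^3 - 8 * A^2 + 5 * A + 1)"
proof -
  \<comment> \<open>This factor clears the denominators of the three prescribed values; k times each
    coefficient turns out to be a polynomial in A.\<close>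
  define k where "k = 4 * A * (A - 1)"
  define \<alpha> where "\<alpha> = - (e1 + e2 + e3)"
  define \<beta> where "\<beta> = e1 * e2 + e1 * e3 + e2 * e3"
  define \<gamma> where "\<gamma> = - (e1 * e2 * e3)"
  have k0: "k \<noteq> 0" using A by (simp add: k_def)
  have c: "k * \<gamma> = A^2"
  proof -
    have "\<gamma> = A / (4 * (A - 1))"
      unfolding R0[symmetric] \<gamma>_def by algebra
    moreover have "4 * (A - 1) \<noteq> 0"
      using A by simp
    ultimately have "\<gamma> * (4 * (A - 1)) = A"
      by (metis nonzero_eq_divide_eq)
    moreover have "k * \<gamma> = A * (\<gamma> * (4 * (A - 1)))"
      by (simp add: k_def)
    ultimately show ?thesis
      by (simp add: power2_eq_square)
  qed
  have R1': "k * (1 + \<alpha> + \<beta> + \<gamma>) = (A - 1)^4"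
  proof -
    have "1 + \<alpha> + \<beta> + \<gamma> = (A - 1)^3 / (4 * A)"
      unfolding R1[symmetric] \<alpha>_def \<beta>_def \<gamma>_def by algebra
    then show ?thesis using A by (simp add: k_def eval_nat_numeral)
  qed
  have RA': "k * (A^3 + \<alpha> * A^2 + \<beta> * A + \<gamma>) = A^4 * (A - 1)^2"
  proof -
    have "A^3 + \<alpha> * A^2 + \<beta> * A + \<gamma> = A^3 * (A - 1) / 4"
      unfolding RA[symmetric] \<alpha>_def \<beta>_def \<gamma>_def by algebra
    moreover have "4 * X = Y" if "X = Y / 4" for X Y :: complex
      unfolding that by simp
    ultimately have quad: "4 * (A^3 + \<alpha> * A^2 + \<beta> * A + \<gamma>) = A^3 * (A - 1)"
      by blast
    have "k * (A^3 + \<alpha> * A^2 + \<beta> * A + \<gamma>) = A * (A - 1) * (4 * (A^3 + \<alpha> * A^2 + \<beta> * A + \<gamma>))"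
      by (simp add: k_def)
    also have "\<dots> = A^4 * (A - 1)^2"
      unfolding quad by (simp add: eval_nat_numeral)
    finally show ?thesis .
  qed
  have sum: "k * \<alpha> + k * \<beta> = (A - 1)^4 - A^2 - k"
    using R1' c by (simp add: algebra_simps)
  have wsum: "(k * \<alpha>) * A^2 + (k * \<beta>) * A = A^4 * (A - 1)^2 - k * A^3 - A^2"
    using RA' c by (simp add: algebra_simps)
  \<comment> \<open>The combination eliminates \<beta> from the two linear equations.\<close>
  have "A * (A - 1) * (k * \<alpha>) = ((k * \<alpha>) * A^2 + (k * \<beta>) * A) - A * (k * \<alpha> + k * \<beta>)"
    by (simp add: algebra_simps power2_eq_square)
  also have "\<dots> = A * (A - 1) * (A^4 - 6 * A^3 + 3 * A^2 + 2 * A + 1)"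
    unfolding sum wsum unfolding k_def by algebra
  finally have a: "k * \<alpha> = A^4 - 6 * A^3 + 3 * A^2 + 2 * A + 1"
    using A by simp
  have "k * \<beta> = (A - 1)^4 - A^2 - k - k * \<alpha>"
    using sum by (simp add: algebra_simps)
  also have "\<dots> = 2 * A^3 - 2 * A^2 - 2 * A"
    unfolding a unfolding k_def by algebra
  finally have b: "k * \<beta> = 2 * A^3 - 2 * A^2 - 2 * A" .
  have disc: "((e1 - e2) * (e1 - e3) * (e2 - e3))^2 =
      \<alpha>^2 * \<beta>^2 - 4 * \<beta>^3 - 4 * \<alpha>^3 * \<gamma> - 27 * \<gamma>^2 + 18 * \<alpha> * \<beta> * \<gamma>"
    unfolding \<alpha>_def \<beta>_def \<gamma>_def by algebra
  \<comment> \<open>The discriminant is homogeneous of degree 4 in all coefficients, the leading one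
    included, so scaling the cubic by k multiplies it by k^4.\<close>
  have "k^4 * ((e1 - e2) * (e1 - e3) * (e2 - e3))^2 =
      (k * \<alpha>)^2 * (k * \<beta>)^2 - 4 * (k * \<beta>)^3 * k - 4 * (k * \<alpha>)^3 * (k * \<gamma>)
      - 27 * (k * \<gamma>)^2 * k^2 + 18 * (k * \<alpha>) * (k * \<beta>) * (k * \<gamma>) * k"
    unfolding disc by algebra
  also have "16 * \<dots> = k^4 * (A * (A - 1) * (A^3 - 8 * A^2 + 5 * A + 1))"
    unfolding a b c unfolding k_def by algebra
  finally show ?thesis using k0 by simp
qed

section \<open>Level seven\<close>

text \<open>The affine map sending p3 to 0 and p2 to 1 sends p1 to A, and the cubic is interpolated
  there. The discriminant of the transported cubic is also a monomial in q, a, b, c, which brings in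
  E.\<close>

lemma level7_hauptmodul_algebra:
  fixes q a b c e1 e2 e3 p1 p2 p3 :: complex
  assumes nz: "q \<noteq> 0" "a \<noteq> 0" "b \<noteq> 0" "c \<noteq> 0"
    and p12: "p1 - p2 = - (q * c / (a * b^2))"
    and p13: "p1 - p3 = - (q * b / (a^2 * c))"
    and p23: "p2 - p3 = - (q^2 * a / (b * c^2))"
    and R1: "(p1 - e1) * (p1 - e2) * (p1 - e3) = - (q^2 * b^2) / (4 * a^8)"
    and R2: "(p2 - e1) * (p2 - e2) * (p2 - e3) = - (q^4 * c^2) / (4 * b^8)"
    and R3: "(p3 - e1) * (p3 - e2) * (p3 - e3) = - (q^6 * a^2) / (4 * c^8)"
    and disc: "((e1 - e2) * (e1 - e3) * (e2 - e3))^2 = q^7 / 16"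
  defines "A \<equiv> b^2 * c / (q * a^3)" and "E \<equiv> (a * b * c)^4 / q"
  shows "A \<noteq> 0" "A \<noteq> 1" "c^2 * a / b^3 = (A - 1) / A" "q * a^2 * b / c^3 = 1 / (A - 1)"
    and "A^3 - 8 * A^2 + 5 * A + 1 = E * (A * (A - 1))"
proof -
  define m where "m = p2 - p3"
  have m0: "m \<noteq> 0" using nz by (simp add: m_def p23)
  show A0: "A \<noteq> 0" using nz by (simp add: A_def)
  have pA: "p1 - p3 = A * m"
    unfolding m_def p13 p23 A_def using nz by (simp add: field_simps eval_nat_numeral)
  have "p1 - p2 = c^3 / (q * a^2 * b) * m"
    unfolding m_def p12 p23 using nz by (simp add: field_simps eval_nat_numeral)
  \<comment> \<open>Additivity of the differences is the three-term relation among a, b, c, the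
    Klein quartic; it makes A - 1 a monomial.\<close>
  moreover have "p1 - p2 = (A - 1) * m"
    using pA by (simp add: m_def algebra_simps)
  ultimately have "(A - 1) * m = c^3 / (q * a^2 * b) * m"
    by simp
  then have A1: "A - 1 = c^3 / (q * a^2 * b)"
    using m0 mult_right_cancel by blast
  then show A1': "A \<noteq> 1" using nz by auto
  show "q * a^2 * b / c^3 = 1 / (A - 1)"
    unfolding A1 by simp
  have A1_A: "(A - 1) / A = c^2 * a / b^3"
    unfolding A1 unfolding A_def using nz by (simp add: field_simps eval_nat_numeral)
  then show "c^2 * a / b^3 = (A - 1) / A" by simp
  have m3: "m^3 = - (q^6 * a^3 / (b^3 * c^6))"
    unfolding m_def p23 using nz by (simp add: field_simps eval_nat_numeral)
  define f where "f e = (e - p3) / m" for e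
  have cubic: "(X - f e1) * (X - f e2) * (X - f e3) = (x - e1) * (x - e2) * (x - e3) / m^3"
    if "x - p3 = X * m" for X x
  proof -
    have "X - f e = (x - e) / m" for e
      using that m0 by (simp add: f_def field_simps)
    then show ?thesis by (simp add: power3_eq_cube)
  qed
  have "16 * ((f e1 - f e2) * (f e1 - f e3) * (f e2 - f e3))^2 = A * (A - 1) * (A^3 - 8 * A^2 + 5 * A + 1)"
  proof (rule discriminant_by_interpolation[OF A0 A1'])
    have "(0 - f e1) * (0 - f e2) * (0 - f e3) = - (q^6 * a^2) / (4 * c^8) / m^3"
      unfolding R3[symmetric] by (rule cubic) simp
    also have "\<dots> = 1 / (4 * ((A - 1) / A))"
      unfolding m3 A1_A using nz by (simp add: field_simps eval_nat_numeral)
    also have "\<dots> = A / (4 * (A - 1))"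
      by simp
    finally show "(0 - f e1) * (0 - f e2) * (0 - f e3) = A / (4 * (A - 1))" .
    have "(1 - f e1) * (1 - f e2) * (1 - f e3) = - (q^4 * c^2) / (4 * b^8) / m^3"
      unfolding R2[symmetric] by (rule cubic) (simp add: m_def)
    also have "\<dots> = (A - 1)^3 / (4 * A)"
      unfolding m3 A1 unfolding A_def using nz by (simp add: field_simps eval_nat_numeral)
    finally show "(1 - f e1) * (1 - f e2) * (1 - f e3) = (A - 1)^3 / (4 * A)" .
    have "(A - f e1) * (A - f e2) * (A - f e3) = - (q^2 * b^2) / (4 * a^8) / m^3"
      unfolding R1[symmetric] by (rule cubic[OF pA])
    also have "\<dots> = A^3 * (A - 1) / 4"
      unfolding m3 A1 unfolding A_def using nz by (simp add: field_simps eval_nat_numeral)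
    finally show "(A - f e1) * (A - f e2) * (A - f e3) = A^3 * (A - 1) / 4" .
  qed
  \<comment> \<open>The product of root differences scales by m^(-3), so \<open>disc\<close> turns
    the interpolated discriminant into q^7 / m^6.\<close>
  moreover have "(f e1 - f e2) * (f e1 - f e3) * (f e2 - f e3) = (e1 - e2) * (e1 - e3) * (e2 - e3) / m^3"
  proof -
    have "f x - f y = (x - y) / m" for x y
      by (simp add: f_def diff_divide_distrib)
    then show ?thesis by (simp add: power3_eq_cube)
  qed
  ultimately have "q^7 / (m^3)^2 = A * (A - 1) * (A^3 - 8 * A^2 + 5 * A + 1)"
    by (simp add: power_divide disc)
  moreover have "q^7 / (m^3)^2 = A * (A - 1) * (E * (A * (A - 1)))"
    unfolding m3 A1 E_def unfolding A_def using nz by (simp add: field_simps eval_nat_numeral)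
  ultimately show "A^3 - 8 * A^2 + 5 * A + 1 = E * (A * (A - 1))"
    using A0 A1' by simp
qed

text \<open>Up to the symmetry z to p/z, doubling permutes the torsion points q, q^2, q^3
  cyclically. Hence differences and cubic values of P at these points involve only a, b, c.\<close>

lemma level7_theta_relations:
  fixes q :: complex
  assumes q: "q \<noteq> 0" "norm q < 1"
  defines "a \<equiv> theta q (q^7)" and "b \<equiv> theta (q^2) (q^7)" and "c \<equiv> theta (q^3) (q^7)"
  defines "A \<equiv> b^2 * c / (q * a^3)" and "E \<equiv> (a * b * c)^4 / q"
  shows "a \<noteq> 0" "b \<noteq> 0" "c \<noteq> 0"
    and "A \<noteq> 0" "A \<noteq> 1" "c^2 * a / b^3 = (A - 1) / A" "q * a^2 * b / c^3 = 1 / (A - 1)"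
    and "A^3 - 8 * A^2 + 5 * A + 1 = E * (A * (A - 1))"
proof -
  let ?p = "q^7"
  have p: "?p \<noteq> 0" "norm ?p < 1"
    using q by (auto simp: norm_power power_less_one_iff)
  have *: "theta (q^k) ?p \<noteq> 0" if "0 < k" "k < 7" for k
  proof -
    have "q^7 = q^(7 - k) * q^k"
      using that by (simp add: power_add[symmetric])
    then have "?p / q^k = q^(7 - k)"
      using q by simp
    then show ?thesis
      using that q by (auto simp: theta_def norm_power power_less_one_iff intro!: qprod_neq_0[OF p(2)])
  qed
  show nz: "a \<noteq> 0" "b \<noteq> 0" "c \<noteq> 0"
    using *[of 1] *[of 2] *[of 3] by (auto simp: a_def b_def c_def)
  define s where "s = csqrt ?p"
  have s: "s^2 = ?p" by (simp add: s_def)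
  obtain P where P: "\<And>x y. \<lbrakk>x \<noteq> 0; y \<noteq> 0; theta x ?p \<noteq> 0; theta y ?p \<noteq> 0\<rbrakk> \<Longrightarrow>
      P x - P y = y * theta (x * y) ?p * theta (x / y) ?p / ((theta x ?p)^2 * (theta y ?p)^2)"
    using theta_weierstrass[OF p] by blast
  note cubic = theta_weierstrass_cubic[OF p s P]
  have refl: "theta (q^4) ?p = c" "theta (q^5) ?p = b" "theta (q^6) ?p = a"
  proof -
    have "?p / q^3 = q^4" "?p / q^2 = q^5" "?p / q = q^6"
      using q by (simp_all add: field_simps eval_nat_numeral)
    then show "theta (q^4) ?p = c" "theta (q^5) ?p = b" "theta (q^6) ?p = a"
      using theta_nome_divide[OF p(1), of "q^3"] theta_nome_divide[OF p(1), of "q^2"]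
        theta_nome_divide[OF p(1), of q] q by (simp_all add: a_def b_def c_def)
  qed
  have inv: "theta (1 / q) ?p = - a / q" "theta (1 / q^2) ?p = - b / q^2"
    using theta_inverse[OF p(2,1), of q] theta_inverse[OF p(2,1), of "q^2"] q
    by (simp_all add: a_def b_def)
  have prods: "q * q^2 = q^3" "q * q^3 = q^4" "q^2 * q^3 = q^5"
    by (simp_all add: power_add[symmetric] flip: power_Suc)
  have quots: "q / q^2 = 1 / q" "q / q^3 = 1 / q^2" "q^2 / q^3 = 1 / q"
    using q by (simp_all add: field_simps eval_nat_numeral)
  have d12: "P q - P (q^2) = - (q * c / (a * b^2))"
    using P[of q "q^2"] q nz by (simp add: prods quots inv flip: a_def b_def c_def)
       (simp add: field_simps eval_nat_numeral)
  have d13: "P q - P (q^3) = - (q * b / (a^2 * c))"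
    using P[of q "q^3"] q nz by (simp add: prods quots inv refl flip: a_def b_def c_def)
       (simp add: field_simps eval_nat_numeral)
  have d23: "P (q^2) - P (q^3) = - (q^2 * a / (b * c^2))"
    using P[of "q^2" "q^3"] q nz by (simp add: prods quots inv refl flip: a_def b_def c_def)
       (simp add: field_simps eval_nat_numeral)
  have sq: "(q^2)^2 = q^4" "(q^3)^2 = q^6"
    by (simp_all flip: power_mult)
  have R1: "(P q - P (- 1)) * (P q - P s) * (P q - P (- s)) = - (q^2 * b^2) / (4 * a^8)"
    using cubic(1)[of q] q nz by (simp flip: a_def b_def)
  have R2: "(P (q^2) - P (- 1)) * (P (q^2) - P s) * (P (q^2) - P (- s)) = - (q^4 * c^2) / (4 * b^8)"
    using cubic(1)[of "q^2"] q nz by (simp add: sq refl flip: b_def)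
  have R3: "(P (q^3) - P (- 1)) * (P (q^3) - P s) * (P (q^3) - P (- s)) = - (q^6 * a^2) / (4 * c^8)"
    using cubic(1)[of "q^3"] q nz by (simp add: sq refl flip: c_def)
  note main = level7_hauptmodul_algebra[OF q(1) nz d12 d13 d23 R1 R2 R3 cubic(2), folded A_def E_def]
  show "A \<noteq> 0" "A \<noteq> 1" "c^2 * a / b^3 = (A - 1) / A" "q * a^2 * b / c^3 = 1 / (A - 1)"
    "A^3 - 8 * A^2 + 5 * A + 1 = E * (A * (A - 1))"
    using main by auto
qed

text \<open>The hypothesis makes A a root of T^3 - (E+8) T^2 + (E+5) T + 1, whose other roots are
  (A-1)/A and -1/(A-1). The two sums are those of the squared roots and of their squared
  reciprocals.\<close>

lemma hauptmodul_power_sums: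
  fixes A E :: complex
  assumes "A \<noteq> 0" "A \<noteq> 1" and E: "A^3 - 8 * A^2 + 5 * A + 1 = E * (A * (A - 1))"
  shows "A^2 + ((A - 1) / A)^2 + (1 / (A - 1))^2 = E^2 + 14 * E + 54"
    and "1 / A^2 + 1 / ((A - 1) / A)^2 + 1 / (1 / (A - 1))^2 = E^2 + 12 * E + 41"
proof -
  define D where "D = A * (A - 1)"
  have D: "D \<noteq> 0" using assms by (simp add: D_def)
  have ED: "E * D = A^3 - 8 * A^2 + 5 * A + 1" using E by (simp add: D_def)
  have "D^2 * (A^2 + ((A - 1) / A)^2 + (1 / (A - 1))^2) = (A * D)^2 + ((A - 1)^2)^2 + A^2"
    using assms by (simp add: D_def distrib_left power_mult_distrib power_divide eval_nat_numeral)
  \<comment> \<open>After multiplication by D^2, E enters only through E D, a polynomial in A, so a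
    polynomial identity remains.\<close>
  also have "\<dots> = (E * D)^2 + 14 * (E * D) * D + 54 * D^2"
    unfolding ED unfolding D_def by algebra
  also have "\<dots> = D^2 * (E^2 + 14 * E + 54)"
    by (simp add: algebra_simps power2_eq_square)
  finally show "A^2 + ((A - 1) / A)^2 + (1 / (A - 1))^2 = E^2 + 14 * E + 54"
    using D by simp
  have "D^2 * (1 / A^2 + 1 / ((A - 1) / A)^2 + 1 / (1 / (A - 1))^2) = (A - 1)^2 + (A^2)^2 + (D * (A - 1))^2"
    using assms by (simp add: D_def distrib_left power_mult_distrib power_divide eval_nat_numeral)
  also have "\<dots> = (E * D)^2 + 12 * (E * D) * D + 41 * D^2"
    unfolding ED unfolding D_def by algebra
  also have "\<dots> = D^2 * (E^2 + 12 * E + 41)"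
    by (simp add: algebra_simps power2_eq_square)
  finally show "1 / A^2 + 1 / ((A - 1) / A)^2 + 1 / (1 / (A - 1))^2 = E^2 + 12 * E + 41"
    using D by simp
qed

section \<open>Translation to u, v, w and the eta quotient\<close>

lemma prodinf_theta:
  assumes "q \<noteq> 0" "norm q < 1" "j \<le> 7"
  shows "(\<Prod>k. (1 - q ^ (7*k+j)) * (1 - q ^ (7*k+(7-j))) * (1 - q ^ (7*k+7)))
    = theta (q^j) (q^7) * qprod (q^7) (q^7)"
proof -
  have "norm (q^7) < 1"
    using assms by (simp add: norm_power power_less_one_iff)
  note h = convergent_prod_has_prod[OF convergent_qprod[OF this], folded qprod_def]
  have eq: "q^7 / q^j = q^(7 - j)"
    using assms by (simp add: power_diff)
  have "(\<lambda>k. (1 - q^j * (q^7)^k) * (1 - q^7 / q^j * (q^7)^k) * (1 - q^7 * (q^7)^k))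
      has_prod (qprod (q^j) (q^7) * qprod (q^7 / q^j) (q^7) * qprod (q^7) (q^7))"
    by (intro has_prod_mult h)
  moreover have "q^i * (q^7)^k = q^(7 * k + i)" for i k
    by (simp add: power_add power_mult)
  ultimately have "(\<lambda>k. (1 - q ^ (7*k+j)) * (1 - q ^ (7*k+(7-j))) * (1 - q ^ (7*k+7)))
      has_prod (theta (q^j) (q^7) * qprod (q^7) (q^7))"
    unfolding eq by (simp add: theta_def eq)
  then show ?thesis
    by (rule has_prod_unique[symmetric])
qed

lemma qpow_mult_nat: "qpow (of_nat n * \<alpha>) \<tau> = qpow \<alpha> \<tau> ^ n"
  by (simp add: qpow_def exp_of_nat_mult[symmetric] mult_ac)

lemma nome_bounds:
  assumes "Im \<tau> > 0"
  shows "nome \<tau> \<noteq> 0" "norm (nome \<tau>) < 1"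
  using assms by (auto simp: nome_def)

text \<open>Choosing t as a 56th root of q makes all fractional powers integral, with exponents 1, 9
  and 25.\<close>

lemma ru_rv_rw_theta:
  assumes "Im \<tau> > 0"
  defines "q \<equiv> nome \<tau>"
  defines "t \<equiv> qpow (1/56) \<tau>" and "Q \<equiv> qprod (q^7) (q^7)"
  shows "ru \<tau> = t * (theta (q^3) (q^7) * Q)" "rv \<tau> = t^9 * (theta (q^2) (q^7) * Q)"
    "rw \<tau> = t^25 * (theta q (q^7) * Q)" "t^56 = q" "t \<noteq> 0"
proof -
  note q = nome_bounds[OF assms(1), folded q_def]
  show "ru \<tau> = t * (theta (q^3) (q^7) * Q)"
    using prodinf_theta[OF q, of 3] by (simp add: ru_def q_def t_def Q_def)
  show "rv \<tau> = t^9 * (theta (q^2) (q^7) * Q)"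
    using prodinf_theta[OF q, of 2] qpow_mult_nat[of 9 "1/56" \<tau>]
    by (simp add: rv_def q_def t_def Q_def)
  show "rw \<tau> = t^25 * (theta q (q^7) * Q)"
    using prodinf_theta[OF q, of 1] qpow_mult_nat[of 25 "1/56" \<tau>]
    by (simp add: rw_def q_def t_def Q_def)
  show "t^56 = q"
    using qpow_mult_nat[of 56 "1/56" \<tau>] by (simp add: q_def t_def nome_def qpow_def)
  show "t \<noteq> 0" by (simp add: t_def qpow_def)
qed

lemma deta_quotient:
  assumes "Im \<tau> > 0"
  defines "q \<equiv> nome \<tau>"
  shows "(deta \<tau> / deta (7 * \<tau>))^4 = (theta q (q^7) * theta (q^2) (q^7) * theta (q^3) (q^7))^4 / q"
proof -
  note q = nome_bounds[OF assms(1), folded q_def]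
  have p: "norm (q^7) < 1"
    using q by (simp add: norm_power power_less_one_iff)
  let ?Q = "qprod (q^7) (q^7)"
  have Q: "?Q \<noteq> 0" by (rule qprod_neq_0[OF p p])
  have d1: "deta \<tau> = qpow (1/24) \<tau> * qprod q q"
    by (simp add: deta_def qprod_def q_def)
  have "nome (7 * \<tau>) = q^7"
    by (simp add: q_def nome_def exp_of_nat_mult[symmetric] mult_ac)
  then have d7: "deta (7 * \<tau>) = qpow (1/24) (7 * \<tau>) * ?Q"
    by (simp add: deta_def qprod_def)
  \<comment> \<open>Splitting modulo 7, the residues j and 7-j pair up into three thetas, and the
    class of multiples of 7 cancels against the denominator.\<close>
  have "qprod q q = (\<Prod>j<7. qprod (q * q^j) (q^7))"
    by (rule qprod_split[OF q(2)]) simp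
  also have "\<dots> = qprod q (q^7) * qprod (q^2) (q^7) * qprod (q^3) (q^7) * qprod (q^4) (q^7)
      * qprod (q^5) (q^7) * qprod (q^6) (q^7) * ?Q"
    by (simp add: eval_nat_numeral)
  also have "\<dots> = theta q (q^7) * theta (q^2) (q^7) * theta (q^3) (q^7) * ?Q"
  proof -
    have "q^7 / q = q^6" "q^7 / q^2 = q^5" "q^7 / q^3 = q^4"
      using q by (simp_all add: field_simps eval_nat_numeral)
    then show ?thesis by (simp add: theta_def mult_ac)
  qed
  finally have "deta \<tau> / deta (7 * \<tau>) = qpow (1/24) \<tau> / qpow (1/24) (7 * \<tau>) *
      (theta q (q^7) * theta (q^2) (q^7) * theta (q^3) (q^7))"
    unfolding d1 d7 using Q by simp
  \<comment> \<open>The exponent is 1/24 - 7/24 = -1/4, so the fourth power is exactly 1/q.\<close>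
  moreover have "(qpow (1/24) \<tau> / qpow (1/24) (7 * \<tau>))^4 = 1 / q"
  proof -
    have "qpow (1/24) \<tau> / qpow (1/24) (7 * \<tau>) = exp (- (of_real pi * \<i> * \<tau> / 2))"
      unfolding qpow_def exp_diff[symmetric] by (rule arg_cong[of _ _ exp]) (simp add: algebra_simps)
    then have "(qpow (1/24) \<tau> / qpow (1/24) (7 * \<tau>))^4 = exp (- (2 * of_real pi * \<i> * \<tau>))"
      by (simp add: mult_ac flip: exp_of_nat_mult)
    then show ?thesis
      by (simp add: q_def nome_def exp_minus inverse_eq_divide)
  qed
  ultimately show ?thesis
    by (simp only: power_mult_distrib) simp
qed

theorem theorem7:
  fixes \<tau> :: complex
  assumes "Im \<tau> > 0"
  defines "u \<equiv> ru \<tau>" and "v \<equiv> rv \<tau>" and "w \<equiv> rw \<tau>"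
      and "E \<equiv> (deta \<tau> / deta (7 * \<tau>)) ^ 4"
  shows "v^4 * u^2 / w^6 + u^4 * w^2 / v^6 + w^4 * v^2 / u^6 = E^2 + 14 * E + 54 \<and>
         w^6 / (v^4 * u^2) + v^6 / (u^4 * w^2) + u^6 / (w^4 * v^2) = E^2 + 12 * E + 41"
proof -
  define q where "q = nome \<tau>"
  define t where "t = qpow (1/56) \<tau>"
  define Q where "Q = qprod (q^7) (q^7)"
  define a b c where "a = theta q (q^7)" and "b = theta (q^2) (q^7)" and "c = theta (q^3) (q^7)"
  define A where "A = b^2 * c / (q * a^3)"
  note q = nome_bounds[OF assms(1), folded q_def]
  note uvw = ru_rv_rw_theta[OF assms(1), folded q_def, folded t_def Q_def a_def b_def c_def u_def v_def w_def]
  have E: "E = (a * b * c)^4 / q"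
    unfolding E_def a_def b_def c_def q_def by (rule deta_quotient[OF assms(1)])
  note rel = level7_theta_relations[OF q, folded a_def b_def c_def, folded A_def E]
  have "norm (q^7) < 1"
    using q by (simp add: norm_power power_less_one_iff)
  then have Q: "Q \<noteq> 0"
    unfolding Q_def by (intro qprod_neq_0)
  have nz: "t \<noteq> 0" "Q \<noteq> 0" "a \<noteq> 0" "b \<noteq> 0" "c \<noteq> 0"
    using uvw(5) Q rel(1,2,3) by auto
  \<comment> \<open>In these three quotients the factors Q cancel and the exponents of t add up to
    -56, 0 and 56, leaving 1/q, 1 and q.\<close>
  have X: "v^2 * u / w^3 = A"
    unfolding A_def uvw(1,2,3) uvw(4)[symmetric] using nz
    by (simp add: power_mult_distrib divide_simps) algebra
  have Y: "u^2 * w / v^3 = (A - 1) / A"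
    unfolding rel(6)[symmetric] uvw(1,2,3) using nz
    by (simp add: power_mult_distrib divide_simps) algebra
  have Z: "w^2 * v / u^3 = 1 / (A - 1)"
    unfolding rel(7)[symmetric] uvw(1,2,3) uvw(4)[symmetric] using nz
    by (simp add: power_mult_distrib divide_simps) algebra
  have sq: "v^4 * u^2 / w^6 = (v^2 * u / w^3)^2" "u^4 * w^2 / v^6 = (u^2 * w / v^3)^2"
    "w^4 * v^2 / u^6 = (w^2 * v / u^3)^2"
    by (simp_all add: power_divide power_mult_distrib flip: power_mult)
  have inv: "w^6 / (v^4 * u^2) = 1 / (v^2 * u / w^3)^2" "v^6 / (u^4 * w^2) = 1 / (u^2 * w / v^3)^2"
    "u^6 / (w^4 * v^2) = 1 / (w^2 * v / u^3)^2"
    by (simp_all add: power_divide power_mult_distrib flip: power_mult)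
  show ?thesis
    unfolding sq inv X Y Z using hauptmodul_power_sums[OF rel(4,5,8)] by simp
qed

end
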